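(* $(\mathcal{M},m,\succ,\prec)$, where $m$ is the concatenation product, is the free $\mathcal{BG}$-algebra generated by $\bullet$. That is, it is a $\mathcal{BG}$-algebra, and for every $\mathcal{BG}$-algebra $A$ and every $a\in A$ there is a unique morphism of $\mathcal{BG}$-algebras $\phi:\mathcal{M}\to A$ with $\phi(\bullet)=a$.
   Context: $\mathbb{K}$ is a commutative field of any characteristic. A bigraft algebra ($\mathcal{BG}$-algebra) is a $\mathbb{K}$-vector space $A$ with three linear maps $\ast,\succ,\prec:A\otimes A\to A$ such that for all $x,y,z\in A$: $(x\ast y)\ast z=x\ast(y\ast z)$, $(x\ast y)\succ z=x\succ(y\succ z)$, $(x\succ y)\ast z=x\succ(y\ast z)$, $(x\prec y)\prec z=x\prec(y\ast z)$, $(x\ast y)\prec z=x\ast(y\prec z)$, $(x\succ y)\prec z=x\succ(y\prec z)$. No unit is assumed. Morphisms are linear maps preserving the three operations. We consider planar rooted forests (finite ordered sequences of planar rooted trees) whose edges are decorated by $l$ or $r$; $1$ is the empty forest and $\bullet$ the tree with one vertex. For two such forests $F,G$, $B(F\otimes G)$ is the tree obtained by grafting the roots of the trees of $F$ followed by those of $G$ (in this left-to-right order) on a common new root, the edges from the new root to the roots of $F$ being decorated by $l$ and those to the roots of $G$ by $r$. In particular $B(1\otimes 1)=\bullet$. Let $\mathbb{T}$ be the set consisting of $1$ and of the trees obtained inductively as $B(F_1\cdots F_p\otimes G_1\cdots G_q)$, $p,q\ge 0$, with all $F_i,G_j$ nonempty trees already in $\mathbb{T}$; $\mathbb{F}$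 is the set of forests all of whose trees are in $\mathbb{T}$ (including $1$). $\mathcal{M}$ is the $\mathbb{K}$-vector space with basis $\mathbb{F}\setminus\{1\}$. For $F=F_1\cdots F_n$ and $G=G_1\cdots G_k$ in $\mathbb{F}\setminus\{1\}$ (the $F_i,G_j$ nonempty trees), with $F_1=B(F_1^1\otimes F_1^2)$ and $G_k=B(G_k^1\otimes G_k^2)$, set $G\succ F=B(GF_1^1\otimes F_1^2)F_2\cdots F_n$ and $G\prec F=G_1\cdots G_{k-1}B(G_k^1\otimes G_k^2F)$, extended bilinearly to $\mathcal{M}$. *)

theory Defs
  imports Complex_Main "HOL-Library.Poly_Mapping"
begin

text \<open>A linear map on the tensor square of \<open>A\<close> is given by a map of two arguments that is linear
  in each of them.\<close>

definition bilinear_op :: "('k::field \<Rightarrow> 'a::ab_group_add \<Rightarrow> 'a) \<Rightarrow> ('a \<Rightarrow> 'a \<Rightarrow> 'a) \<Rightarrow> bool" where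
  "bilinear_op scale f \<longleftrightarrow>
     (\<forall>x. Vector_Spaces.linear scale scale (\<lambda>y. f x y)) \<and>
     (\<forall>y. Vector_Spaces.linear scale scale (\<lambda>x. f x y))"

locale bg_algebra = vector_space scale
  for scale :: "'k::field \<Rightarrow> 'a::ab_group_add \<Rightarrow> 'a" +
  fixes ast :: "'a \<Rightarrow> 'a \<Rightarrow> 'a" (infixl \<open>\<^bold>*\<close> 70)
    and succ :: "'a \<Rightarrow> 'a \<Rightarrow> 'a" (infixl \<open>\<^bold>\<succ>\<close> 70)
    and prec :: "'a \<Rightarrow> 'a \<Rightarrow> 'a" (infixl \<open>\<^bold>\<prec>\<close> 70)
  assumes bilinear_ast: "bilinear_op scale (\<^bold>*)"
    and bilinear_succ: "bilinear_op scale (\<^bold>\<succ>)"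
    and bilinear_prec: "bilinear_op scale (\<^bold>\<prec>)"
    and ast_ast: "(x \<^bold>* y) \<^bold>* z = x \<^bold>* (y \<^bold>* z)"
    and ast_succ: "(x \<^bold>* y) \<^bold>\<succ> z = x \<^bold>\<succ> (y \<^bold>\<succ> z)"
    and succ_ast: "(x \<^bold>\<succ> y) \<^bold>* z = x \<^bold>\<succ> (y \<^bold>* z)"
    and prec_prec: "(x \<^bold>\<prec> y) \<^bold>\<prec> z = x \<^bold>\<prec> (y \<^bold>* z)"
    and ast_prec: "(x \<^bold>* y) \<^bold>\<prec> z = x \<^bold>* (y \<^bold>\<prec> z)"
    and succ_prec: "(x \<^bold>\<succ> y) \<^bold>\<prec> z = x \<^bold>\<succ> (y \<^bold>\<prec> z)"

locale bg_morphism =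
  source: bg_algebra scale1 ast1 succ1 prec1 +
  target: bg_algebra scale2 ast2 succ2 prec2 +
  Vector_Spaces.linear scale1 scale2 \<phi>
  for scale1 :: "'k::field \<Rightarrow> 'a::ab_group_add \<Rightarrow> 'a" and ast1 succ1 prec1
    and scale2 :: "'k \<Rightarrow> 'b::ab_group_add \<Rightarrow> 'b" and ast2 succ2 prec2
    and \<phi> :: "'a \<Rightarrow> 'b" +
  assumes map_ast: "\<phi> (ast1 x y) = ast2 (\<phi> x) (\<phi> y)"
    and map_succ: "\<phi> (succ1 x y) = succ2 (\<phi> x) (\<phi> y)"
    and map_prec: "\<phi> (prec1 x y) = prec2 (\<phi> x) (\<phi> y)"

datatype side = L | R

text \<open>A vertex comes with the list, from left to right, of its outgoing edges, each given by its
  decoration and the subtree it leads to.\<close>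

datatype tree = Vertex "(side \<times> tree) list"

type_synonym forest = "tree list"

definition graft :: "forest \<Rightarrow> forest \<Rightarrow> tree" where
  "graft F G = Vertex (map (Pair L) F @ map (Pair R) G)"

inductive_set bg_trees :: "tree set" where
  "F \<in> lists bg_trees \<Longrightarrow> G \<in> lists bg_trees \<Longrightarrow> graft F G \<in> bg_trees"
monos lists_mono

abbreviation bg_forests :: "forest set" where
  "bg_forests \<equiv> lists bg_trees"

fun left_part :: "tree \<Rightarrow> forest" where
  "left_part (Vertex es) = map snd (filter (\<lambda>e. fst e = L) es)"

fun right_part :: "tree \<Rightarrow> forest" where
  "right_part (Vertex es) = map snd (filter (\<lambda>e. fst e = R) es)"

lemma left_part_graft [simp]: "left_part (graft F G) = F"
  by (simp add: graft_def filter_map o_def)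

lemma right_part_graft [simp]: "right_part (graft F G) = G"
  by (simp add: graft_def filter_map o_def)

lemma bg_trees_iff:
  "t \<in> bg_trees \<longleftrightarrow> (\<exists>F\<in>bg_forests. \<exists>G\<in>bg_forests. t = graft F G)"
  by (subst bg_trees.simps) blast

definition forest_succ :: "forest \<Rightarrow> forest \<Rightarrow> forest" where
  "forest_succ G F = graft (G @ left_part (hd F)) (right_part (hd F)) # tl F"

definition forest_prec :: "forest \<Rightarrow> forest \<Rightarrow> forest" where
  "forest_prec G F = butlast G @ [graft (left_part (last G)) (right_part (last G) @ F)]"

lemma forest_succ_graft:
  "forest_succ G (graft F1 F2 # Fs) = graft (G @ F1) F2 # Fs"
  by (simp add: forest_succ_def)

lemma forest_prec_graft:
  "forest_prec (Gs @ [graft G1 G2]) F = Gs @ [graft G1 (G2 @ F)]"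
  by (simp add: forest_prec_def)

lemma forest_succ_closed:
  assumes "G \<in> bg_forests" "F \<in> bg_forests" "F \<noteq> []"
  shows "forest_succ G F \<in> bg_forests"
proof -
  obtain t ts where F: "F = t # ts" "t \<in> bg_trees" "ts \<in> bg_forests"
    using assms(2,3) by (cases F) auto
  then obtain F1 F2 where "F1 \<in> bg_forests" "F2 \<in> bg_forests" "t = graft F1 F2"
    using bg_trees_iff by blast
  with F assms(1) show ?thesis
    by (auto simp: forest_succ_graft intro!: bg_trees.intros)
qed

lemma forest_prec_closed:
  assumes "G \<in> bg_forests" "F \<in> bg_forests" "G \<noteq> []"
  shows "forest_prec G F \<in> bg_forests"
proof -
  obtain t ts where G: "G = ts @ [t]" "t \<in> bg_trees" "ts \<in> bg_forests"
    using assms(1,3) by (cases G rule: rev_cases) auto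
  then obtain G1 G2 where "G1 \<in> bg_forests" "G2 \<in> bg_forests" "t = graft G1 G2"
    using bg_trees_iff by blast
  with G assms(2) show ?thesis
    by (auto simp: forest_prec_graft intro!: bg_trees.intros)
qed

typedef neforest = "bg_forests - {[]}"
proof
  show "[graft [] []] \<in> bg_forests - {[]}"
    by (auto intro: bg_trees.intros)
qed

setup_lifting type_definition_neforest

lift_definition ne_concat :: "neforest \<Rightarrow> neforest \<Rightarrow> neforest" is "(@)"
  by auto

lift_definition ne_succ :: "neforest \<Rightarrow> neforest \<Rightarrow> neforest" is forest_succ
  using forest_succ_closed by (auto simp: forest_succ_def)

lift_definition ne_prec :: "neforest \<Rightarrow> neforest \<Rightarrow> neforest" is forest_prec
  using forest_prec_closed by (auto simp: forest_prec_def)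

lift_definition ne_dot :: neforest is "[graft [] []]"
  by (auto intro: bg_trees.intros)

text \<open>The vector space with basis \<open>'b\<close> is the type \<open>'b \<Rightarrow>\<^sub>0 'k\<close> of finitely supported coefficient
  functions; \<open>Poly_Mapping.single b 1\<close> is the basis vector \<open>b\<close>.\<close>

type_synonym 'k forest_space = "neforest \<Rightarrow>\<^sub>0 'k"

definition pm_scale :: "'k::field \<Rightarrow> ('b \<Rightarrow>\<^sub>0 'k) \<Rightarrow> ('b \<Rightarrow>\<^sub>0 'k)" where
  "pm_scale c f = Poly_Mapping.map ((*) c) f"

definition bilinear_extension ::
    "('b \<Rightarrow> 'b \<Rightarrow> 'b) \<Rightarrow> ('b \<Rightarrow>\<^sub>0 'k::field) \<Rightarrow> ('b \<Rightarrow>\<^sub>0 'k) \<Rightarrow> ('b \<Rightarrow>\<^sub>0 'k)" where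
  "bilinear_extension h f g =
     (\<Sum>x\<in>Poly_Mapping.keys f. \<Sum>y\<in>Poly_Mapping.keys g.
        Poly_Mapping.single (h x y) (Poly_Mapping.lookup f x * Poly_Mapping.lookup g y))"

definition M_mult :: "'k::field forest_space \<Rightarrow> 'k forest_space \<Rightarrow> 'k forest_space" where
  "M_mult = bilinear_extension ne_concat"

definition M_succ :: "'k::field forest_space \<Rightarrow> 'k forest_space \<Rightarrow> 'k forest_space" where
  "M_succ = bilinear_extension ne_succ"

definition M_prec :: "'k::field forest_space \<Rightarrow> 'k forest_space \<Rightarrow> 'k forest_space" where
  "M_prec = bilinear_extension ne_prec"

definition M_dot :: "'k::field forest_space" where
  "M_dot = Poly_Mapping.single ne_dot 1"

end

theory Submission
  imports Defs
begin

text \<open>The free algebra property reduces to two statements about the basis of nonempty forests.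

  First, every nonempty forest is obtained from \<open>\<bullet>\<close> by the three operations: a forest is the
  concatenation of its trees, and \<open>B(F \<otimes> G) = (F \<succ> \<bullet>) \<prec> G\<close>, where an empty \<open>F\<close> or \<open>G\<close> is simply
  left out. This is \<open>neforest_induct\<close>, and it makes a morphism unique.

  Second, this way of building a forest can be copied in any algebra with a chosen element \<open>a\<close>, and
  the value obtained there turns concatenation and the two graftings into the operations of the
  algebra (\<open>eval_concat\<close>, \<open>eval_succ\<close>, \<open>eval_prec\<close>). Since
  \<open>(x\<^sub>1 * \<dots> * x\<^sub>p) \<succ> a = x\<^sub>1 \<succ> (\<dots> (x\<^sub>p \<succ> a))\<close> and \<open>a \<prec> (y\<^sub>1 * \<dots> * y\<^sub>q) = ((a \<prec> y\<^sub>1) \<dots>) \<prec> y\<^sub>q\<close>,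
  the value of \<open>B(F \<otimes> G)\<close> is a right fold of \<open>\<succ>\<close> over \<open>F\<close> followed by a left fold of \<open>\<prec>\<close> over
  \<open>G\<close>. The folds leave \<open>a\<close> unchanged on empty lists, so the missing unit causes no case distinction,
  and grafting more trees only lengthens a fold.

  The rest is multilinear algebra: the six identities all have the shape \<open>(x \<cdot> y) \<cdot> z = x \<cdot> (y \<cdot> z)\<close> with four
  operations that may differ, so for bilinearly extended operations they only have to be checked on
  the basis, where they are identities between lists.\<close>

section \<open>Linear extension from a basis\<close>

lemma lookup_pm_scale [simp]: "Poly_Mapping.lookup (pm_scale c f) x = c * Poly_Mapping.lookup f x"
  by (simp add: pm_scale_def map.rep_eq when_def)

lemma vector_space_pm_scale: "vector_space pm_scale"
  by unfold_locales (auto intro!: poly_mapping_eqI simp: lookup_add algebra_simps)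

lemma pm_scale_single: "pm_scale c (Poly_Mapping.single b d) = Poly_Mapping.single b (c * d)"
  by (rule poly_mapping_eqI) (auto simp: lookup_single when_def)

lemma bilinear_opD:
  assumes "bilinear_op scale f"
  shows "Vector_Spaces.linear scale scale (f x)"
    and "Vector_Spaces.linear scale scale (\<lambda>x. f x y)"
  using assms unfolding bilinear_op_def by auto

lemma linear_eq_on_basis:
  fixes f g :: "('b \<Rightarrow>\<^sub>0 'k::field) \<Rightarrow> 'a::ab_group_add"
  assumes f: "Vector_Spaces.linear pm_scale s f" and g: "Vector_Spaces.linear pm_scale s g"
    and eq: "\<And>b. f (Poly_Mapping.single b 1) = g (Poly_Mapping.single b 1)"
  shows "f = g"
proof
  interpret f: Vector_Spaces.linear pm_scale s f by (fact f)
  interpret g: Vector_Spaces.linear pm_scale s g by (fact g)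
  fix v :: "'b \<Rightarrow>\<^sub>0 'k"
  have v: "v = (\<Sum>x\<in>Poly_Mapping.keys v. pm_scale (Poly_Mapping.lookup v x) (Poly_Mapping.single x 1))"
    by (rule poly_mapping_eqI)
      (simp add: lookup_sum lookup_single when_def in_keys_iff if_distrib cong: if_cong)
  show "f v = g v"
    by (subst (1 2) v) (simp add: f.sum g.sum f.scale g.scale eq)
qed

definition linear_extension ::
    "('k::field \<Rightarrow> 'a::ab_group_add \<Rightarrow> 'a) \<Rightarrow> ('b \<Rightarrow> 'a) \<Rightarrow> ('b \<Rightarrow>\<^sub>0 'k) \<Rightarrow> 'a" where
  "linear_extension scale v f =
     (\<Sum>x\<in>Poly_Mapping.keys f. scale (Poly_Mapping.lookup f x) (v x))"

context vector_space
begin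

lemma linear_extension_superset:
  assumes "finite S" "Poly_Mapping.keys f \<subseteq> S"
  shows "linear_extension scale v f = (\<Sum>x\<in>S. scale (Poly_Mapping.lookup f x) (v x))"
  unfolding linear_extension_def using assms
  by (intro sum.mono_neutral_left) (auto simp: in_keys_iff)

lemma linear_linear_extension: "Vector_Spaces.linear pm_scale scale (linear_extension scale v)"
proof -
  have add: "linear_extension scale v (f + g) = linear_extension scale v f + linear_extension scale v g"
    for f g
  proof -
    let ?S = "Poly_Mapping.keys f \<union> Poly_Mapping.keys g"
    have "Poly_Mapping.keys (f + g) \<subseteq> ?S" by (rule keys_add)
    then show ?thesis
      by (simp add: linear_extension_superset[of ?S] lookup_add scale_left_distrib sum.distrib)
  qed
  have scale: "linear_extension scale v (pm_scale c f) = scale c (linear_extension scale v f)" for c f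
  proof -
    have "Poly_Mapping.keys (pm_scale c f) \<subseteq> Poly_Mapping.keys f" by (auto simp: in_keys_iff)
    then show ?thesis
      by (simp add: linear_extension_superset[of "Poly_Mapping.keys f"] scale_sum_right)
  qed
  interpret pm: vector_space pm_scale by (rule vector_space_pm_scale)
  show ?thesis
    by unfold_locales (simp_all add: add scale)
qed

lemma linear_extension_single [simp]:
  "linear_extension scale v (Poly_Mapping.single b 1) = v b"
  by (simp add: linear_extension_def)

end

section \<open>Multilinear identities\<close>

text \<open>Writing a bilinear extension as an iterated linear one gives linearity in the outer argument at
  once; linearity in the inner argument then follows by exchanging the arguments.\<close>

lemma bilinear_extension_alt:
  "bilinear_extension h f g =
     linear_extension pm_scale
       (\<lambda>x. linear_extension pm_scale (\<lambda>y. Poly_Mapping.single (h x y) 1) g) f"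
proof -
  interpret vector_space pm_scale by (rule vector_space_pm_scale)
  show ?thesis
    by (simp add: bilinear_extension_def linear_extension_def scale_sum_right pm_scale_single)
qed

lemma bilinear_extension_flip:
  "bilinear_extension h f g = bilinear_extension (\<lambda>x y. h y x) g f"
  unfolding bilinear_extension_def by (subst sum.swap) (simp add: mult.commute)

lemma bilinear_op_bilinear_extension:
  "bilinear_op (pm_scale :: 'k::field \<Rightarrow> ('b \<Rightarrow>\<^sub>0 'k) \<Rightarrow> _) (bilinear_extension h)"
proof -
  interpret vector_space "pm_scale :: 'k \<Rightarrow> ('b \<Rightarrow>\<^sub>0 'k) \<Rightarrow> _" by (rule vector_space_pm_scale)
  have "Vector_Spaces.linear pm_scale pm_scale (\<lambda>f. bilinear_extension h f g)"
    for h and g :: "'b \<Rightarrow>\<^sub>0 'k"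
    unfolding bilinear_extension_alt by (rule linear_linear_extension)
  from this[of h] this[of "\<lambda>x y. h y x"] show ?thesis
    by (simp add: bilinear_op_def flip: bilinear_extension_flip[of h])
qed

lemma bilinear_extension_single [simp]:
  "bilinear_extension h (Poly_Mapping.single x 1) (Poly_Mapping.single y 1) =
     Poly_Mapping.single (h x y) 1"
  by (simp add: bilinear_extension_def)

text \<open>Both sides are linear in each of the three arguments, which can therefore be replaced by basis
  vectors one after the other.\<close>

lemma bilinear_extension_assoc:
  assumes "\<And>x y z. h1 (h2 x y) z = h3 x (h4 y z)"
  shows "bilinear_extension h1 (bilinear_extension h2 u v) w =
         bilinear_extension h3 u (bilinear_extension h4 v w)"
proof -
  note lin = bilinear_opD[OF bilinear_op_bilinear_extension]
  note comp = Vector_Spaces.linear_compose[unfolded o_def]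
  have 1: "bilinear_extension h1
           (bilinear_extension h2 (Poly_Mapping.single x 1) (Poly_Mapping.single y 1)) w =
         bilinear_extension h3 (Poly_Mapping.single x 1)
           (bilinear_extension h4 (Poly_Mapping.single y 1) w)" for x y
    by (rule fun_cong, rule linear_eq_on_basis[OF lin(1) comp[OF lin(1) lin(1)]]) (simp add: assms)
  have 2: "bilinear_extension h1 (bilinear_extension h2 (Poly_Mapping.single x 1) v) w =
         bilinear_extension h3 (Poly_Mapping.single x 1) (bilinear_extension h4 v w)" for x
    by (rule fun_cong[of _ _ v], rule linear_eq_on_basis[OF comp[OF lin(1) lin(2)] comp[OF lin(2) lin(1)]])
      (rule 1)
  show ?thesis
    by (rule fun_cong[of _ _ u], rule linear_eq_on_basis[OF comp[OF lin(2) lin(2)] lin(2)]) (rule 2)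
qed

lemma (in vector_space) linear_extension_bilinear_extension:
  assumes bil: "bilinear_op scale f" and eq: "\<And>x y. v (h x y) = f (v x) (v y)"
  shows "linear_extension scale v (bilinear_extension h u w) =
         f (linear_extension scale v u) (linear_extension scale v w)"
proof -
  note lin = bilinear_opD[OF bilinear_op_bilinear_extension] and lf = bilinear_opD[OF bil]
  note ext = linear_linear_extension[of v]
  note comp = Vector_Spaces.linear_compose[unfolded o_def]
  have 1: "linear_extension scale v (bilinear_extension h (Poly_Mapping.single x 1) w) =
         f (linear_extension scale v (Poly_Mapping.single x 1)) (linear_extension scale v w)" for x
    by (rule fun_cong[of _ _ w], rule linear_eq_on_basis[OF comp[OF lin(1) ext] comp[OF ext lf(1)]])
      (simp add: eq)
  show ?thesis
    by (rule fun_cong[of _ _ u], rule linear_eq_on_basis[OF comp[OF lin(2) ext] comp[OF ext lf(2)]])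
      (rule 1)
qed

section \<open>Nonempty forests\<close>

lemma bg_treeE:
  assumes "t \<in> bg_trees"
  obtains F G where "F \<in> bg_forests" "G \<in> bg_forests" "t = graft F G"
  using assms bg_trees_iff by blast

lemma neforest_ConsE:
  assumes "xs \<in> bg_forests - {[]}"
  obtains F G ts where "xs = graft F G # ts"
  using assms by (auto simp: neq_Nil_conv elim!: bg_treeE)

lemma neforest_snocE:
  assumes "xs \<in> bg_forests - {[]}"
  obtains F G ts where "xs = ts @ [graft F G]"
  using assms by (cases xs rule: rev_cases) (auto elim!: bg_treeE)

lemma ne_concat_concat: "ne_concat (ne_concat x y) z = ne_concat x (ne_concat y z)"
  by transfer simp

lemma ne_concat_succ: "ne_succ (ne_concat x y) z = ne_succ x (ne_succ y z)"
  by transfer (simp add: forest_succ_def)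

lemma ne_succ_concat: "ne_concat (ne_succ x y) z = ne_succ x (ne_concat y z)"
  by transfer (auto simp: forest_succ_def)

lemma ne_prec_prec: "ne_prec (ne_prec x y) z = ne_prec x (ne_concat y z)"
  by transfer (simp add: forest_prec_def)

lemma ne_concat_prec: "ne_prec (ne_concat x y) z = ne_concat x (ne_prec y z)"
  by transfer (auto simp: forest_prec_def butlast_append)

text \<open>The graftings touch the first and the last tree of \<open>y\<close>. If \<open>y\<close> has only one tree, they still
  commute, because they lengthen the left and the right part of its root.\<close>

lemma ne_succ_prec: "ne_prec (ne_succ x y) z = ne_succ x (ne_prec y z)"
proof (transfer)
  fix x y z :: forest
  assume "y \<in> bg_forests - {[]}"
  then obtain F G ts where y: "y = graft F G # ts" by (rule neforest_ConsE)
  show "forest_prec (forest_succ x y) z = forest_succ x (forest_prec y z)"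
    unfolding y by (simp add: forest_succ_def forest_prec_def)
qed

text \<open>It suffices to reach the one-tree forests \<open>[t]\<close>, since concatenation gives all others. A tree
  \<open>B(F \<otimes> G)\<close> comes from \<open>\<bullet>\<close> by grafting the whole of \<open>F\<close> on the left and then the whole of \<open>G\<close> on
  the right.\<close>

lemma nonempty_forest_induct:
  assumes xs: "xs \<in> bg_forests - {[]}"
    and dot: "P [graft [] []]"
    and concat: "\<And>x y. x \<in> bg_forests - {[]} \<Longrightarrow> y \<in> bg_forests - {[]} \<Longrightarrow> P x \<Longrightarrow> P y \<Longrightarrow> P (x @ y)"
    and succ: "\<And>x y. x \<in> bg_forests - {[]} \<Longrightarrow> y \<in> bg_forests - {[]} \<Longrightarrow> P x \<Longrightarrow> P y \<Longrightarrow> P (forest_succ x y)"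
    and prec: "\<And>x y. x \<in> bg_forests - {[]} \<Longrightarrow> y \<in> bg_forests - {[]} \<Longrightarrow> P x \<Longrightarrow> P y \<Longrightarrow> P (forest_prec x y)"
  shows "P xs"
proof -
  have forest: "P F" if "F \<in> lists {t \<in> bg_trees. P [t]}" "F \<noteq> []" for F
    using that
  proof (induction F)
    case (Cons t ts)
    then show ?case
      using concat[of "[t]" ts] by (cases "ts = []") auto
  qed simp
  have tree: "P [t]" if "t \<in> bg_trees" for t
    using that
  proof induction
    case (1 F G)
    have F: "F \<in> lists {t \<in> bg_trees. P [t]}" and G: "G \<in> lists {t \<in> bg_trees. P [t]}"
      using 1 by auto
    then have FG: "F \<in> bg_forests" "G \<in> bg_forests" by auto
    have left: "P [graft F []]"
    proof (cases "F = []")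
      case False
      then show ?thesis
        using succ[of F "[graft [] []]"] forest[OF F] FG dot
        by (auto simp: forest_succ_graft intro!: bg_trees.intros)
    qed (simp add: dot)
    show ?case
    proof (cases "G = []")
      case False
      then show ?thesis
        using prec[of "[graft F []]" G] forest[OF G] FG left
        by (auto simp: forest_prec_def intro!: bg_trees.intros)
    qed (simp add: left)
  qed
  show ?thesis
    using xs tree by (intro forest) auto
qed

lemma neforest_induct [case_names dot concat succ prec]:
  assumes "P ne_dot"
    and "\<And>x y. P x \<Longrightarrow> P y \<Longrightarrow> P (ne_concat x y)"
    and "\<And>x y. P x \<Longrightarrow> P y \<Longrightarrow> P (ne_succ x y)"
    and "\<And>x y. P x \<Longrightarrow> P y \<Longrightarrow> P (ne_prec x y)"
  shows "P b"
proof -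
  have "P (Abs_neforest (Rep_neforest b))"
    using assms
    by (intro nonempty_forest_induct[of "Rep_neforest b" "\<lambda>xs. P (Abs_neforest xs)"] Rep_neforest)
      (simp_all add: ne_dot_def eq_onp_def
        flip: ne_concat.abs_eq ne_succ.abs_eq ne_prec.abs_eq)
  then show ?thesis by (simp add: Rep_neforest_inverse)
qed

text \<open>What remains after \<open>bilinear_extension_assoc\<close> are the identities above on basis vectors.\<close>

theorem bg_algebra_M: "bg_algebra pm_scale M_mult M_succ M_prec"
  unfolding M_mult_def M_succ_def M_prec_def
  by (intro bg_algebra.intro bg_algebra_axioms.intro vector_space_pm_scale
      bilinear_op_bilinear_extension bilinear_extension_assoc ne_concat_concat ne_concat_succ
      ne_succ_concat ne_prec_prec ne_concat_prec ne_succ_prec)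

section \<open>Evaluating forests in an algebra\<close>

lemma size_left_part: "s \<in> set (left_part t) \<Longrightarrow> size s < size t"
  by (cases t) (force dest: size_list_estimation'[of _ _ _ "size_prod (\<lambda>_. 0) size", OF _ order_refl])

lemma size_right_part: "s \<in> set (right_part t) \<Longrightarrow> size s < size t"
  by (cases t) (force dest: size_list_estimation'[of _ _ _ "size_prod (\<lambda>_. 0) size", OF _ order_refl])

context bg_algebra
begin

function eval_tree :: "'a \<Rightarrow> tree \<Rightarrow> 'a" where
  "eval_tree a t =
     foldl (\<^bold>\<prec>) (foldr (\<^bold>\<succ>) (map (eval_tree a) (left_part t)) a) (map (eval_tree a) (right_part t))"
  by auto
termination
  by (relation "measure (\<lambda>(a, t). size t)") (auto simp: size_left_part size_right_part)

declare eval_tree.simps [simp del]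

text \<open>Only nonempty forests have a meaningful value; the algebra has no unit to assign to \<open>1\<close>.\<close>

definition eval_forest :: "'a \<Rightarrow> forest \<Rightarrow> 'a" where
  "eval_forest a F = foldl (\<^bold>*) (eval_tree a (hd F)) (map (eval_tree a) (tl F))"

lemma eval_tree_graft:
  "eval_tree a (graft F G) =
     foldl (\<^bold>\<prec>) (foldr (\<^bold>\<succ>) (map (eval_tree a) F) a) (map (eval_tree a) G)"
  by (subst eval_tree.simps) simp

text \<open>Grafting a product means grafting its factors one at a time: on the left the last factor acts
  first, on the right the first one does. Hence the two different fold directions.\<close>

lemma foldl_ast_succ: "foldl (\<^bold>*) y ys \<^bold>\<succ> z = foldr (\<^bold>\<succ>) (y # ys) z"
  by (induction ys arbitrary: z rule: rev_induct) (simp_all add: ast_succ)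

lemma prec_foldl_ast: "z \<^bold>\<prec> foldl (\<^bold>*) y ys = foldl (\<^bold>\<prec>) z (y # ys)"
  by (induction ys rule: rev_induct) (simp_all add: prec_prec[symmetric])

lemma foldl_ast_ast: "foldl (\<^bold>*) x xs \<^bold>* foldl (\<^bold>*) y ys = foldl (\<^bold>*) x (xs @ y # ys)"
  by (induction ys rule: rev_induct) (simp_all add: ast_ast[symmetric] flip: append_assoc append_Cons)

text \<open>A left action commutes with products and right actions further to the right. In a forest, this
  lets what is grafted on the left of the first tree be pulled out past everything else.\<close>

lemma foldl_ast_foldr_succ: "foldl (\<^bold>*) (foldr (\<^bold>\<succ>) xs y) ys = foldr (\<^bold>\<succ>) xs (foldl (\<^bold>*) y ys)"
proof -
  have "foldl (\<^bold>*) (x \<^bold>\<succ> y) ys = x \<^bold>\<succ> foldl (\<^bold>*) y ys" for x y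
    by (induction ys rule: rev_induct) (simp_all add: succ_ast)
  then show ?thesis by (induction xs) simp_all
qed

lemma foldl_prec_foldr_succ: "foldl (\<^bold>\<prec>) (foldr (\<^bold>\<succ>) xs y) ys = foldr (\<^bold>\<succ>) xs (foldl (\<^bold>\<prec>) y ys)"
proof -
  have "foldl (\<^bold>\<prec>) (x \<^bold>\<succ> y) ys = x \<^bold>\<succ> foldl (\<^bold>\<prec>) y ys" for x y
    by (induction ys rule: rev_induct) (simp_all add: succ_prec)
  then show ?thesis by (induction xs) simp_all
qed

lemma eval_forest_succ_value:
  assumes "F \<noteq> []"
  shows "eval_forest a F \<^bold>\<succ> z = foldr (\<^bold>\<succ>) (map (eval_tree a) F) z"
  using assms by (cases F) (simp_all add: eval_forest_def foldl_ast_succ)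

lemma prec_eval_forest_value:
  assumes "F \<noteq> []"
  shows "z \<^bold>\<prec> eval_forest a F = foldl (\<^bold>\<prec>) z (map (eval_tree a) F)"
  using assms by (cases F) (simp_all add: eval_forest_def prec_foldl_ast)

lemma eval_forest_append:
  assumes "F \<noteq> []" "G \<noteq> []"
  shows "eval_forest a (F @ G) = eval_forest a F \<^bold>* eval_forest a G"
  using assms by (cases F; cases G) (simp_all add: eval_forest_def foldl_ast_ast del: foldl_append)

lemma eval_forest_succ:
  assumes "G \<noteq> []" "F \<in> bg_forests - {[]}"
  shows "eval_forest a (forest_succ G F) = eval_forest a G \<^bold>\<succ> eval_forest a F"
proof -
  obtain F1 F2 ts where F: "F = graft F1 F2 # ts" using assms(2) by (rule neforest_ConsE)
  show ?thesis
    unfolding F eval_forest_succ_value[OF assms(1)]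
    by (simp add: forest_succ_graft eval_forest_def eval_tree_graft foldl_prec_foldr_succ
        foldl_ast_foldr_succ)
qed

lemma eval_forest_prec:
  assumes "G \<in> bg_forests - {[]}" "F \<noteq> []"
  shows "eval_forest a (forest_prec G F) = eval_forest a G \<^bold>\<prec> eval_forest a F"
proof -
  obtain G1 G2 ts where G: "G = ts @ [graft G1 G2]" using assms(1) by (rule neforest_snocE)
  \<comment> \<open>Only the last tree changes, so the claim for one tree suffices.\<close>
  have single: "eval_forest a [graft G1 (G2 @ F)] = eval_forest a [graft G1 G2] \<^bold>\<prec> eval_forest a F"
    unfolding prec_eval_forest_value[OF assms(2)] by (simp add: eval_forest_def eval_tree_graft)
  have grafted: "forest_prec G F = ts @ [graft G1 (G2 @ F)]"
    unfolding G by (rule forest_prec_graft)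
  show ?thesis
    unfolding grafted unfolding G
    by (cases "ts = []") (simp_all add: eval_forest_append ast_prec single)
qed

definition eval :: "'a \<Rightarrow> neforest \<Rightarrow> 'a" where
  "eval a x = eval_forest a (Rep_neforest x)"

lemma eval_dot: "eval a ne_dot = a"
  by (simp add: eval_def ne_dot.rep_eq eval_forest_def eval_tree_graft)

lemma eval_concat: "eval a (ne_concat x y) = eval a x \<^bold>* eval a y"
  using Rep_neforest[of x] Rep_neforest[of y]
  by (simp add: eval_def ne_concat.rep_eq eval_forest_append)

lemma eval_succ: "eval a (ne_succ x y) = eval a x \<^bold>\<succ> eval a y"
  using Rep_neforest[of x] Rep_neforest[of y]
  by (simp add: eval_def ne_succ.rep_eq eval_forest_succ)

lemma eval_prec: "eval a (ne_prec x y) = eval a x \<^bold>\<prec> eval a y"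
  using Rep_neforest[of x] Rep_neforest[of y]
  by (simp add: eval_def ne_prec.rep_eq eval_forest_prec)

end

section \<open>The universal property\<close>

context bg_algebra
begin

lemma bg_morphism_eval:
  "bg_morphism pm_scale M_mult M_succ M_prec scale (\<^bold>*) (\<^bold>\<succ>) (\<^bold>\<prec>) (linear_extension scale (eval a))"
  by (intro bg_morphism.intro bg_morphism_axioms.intro bg_algebra_M bg_algebra_axioms
      linear_linear_extension)
    (simp_all add: M_mult_def M_succ_def M_prec_def linear_extension_bilinear_extension
      bilinear_ast bilinear_succ bilinear_prec eval_concat eval_succ eval_prec)

text \<open>The elements of the basis on which two morphisms agree are closed under the three forest
  operations, so they are all of them as soon as \<open>\<bullet>\<close> is one.\<close>

lemma bg_morphism_eqI:
  assumes "bg_morphism pm_scale M_mult M_succ M_prec scale (\<^bold>*) (\<^bold>\<succ>) (\<^bold>\<prec>) \<phi>"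
    and "bg_morphism pm_scale M_mult M_succ M_prec scale (\<^bold>*) (\<^bold>\<succ>) (\<^bold>\<prec>) \<psi>"
    and dot: "\<phi> M_dot = \<psi> M_dot"
  shows "\<phi> = \<psi>"
proof -
  interpret \<phi>: bg_morphism pm_scale M_mult M_succ M_prec scale "(\<^bold>*)" "(\<^bold>\<succ>)" "(\<^bold>\<prec>)" \<phi> by fact
  interpret \<psi>: bg_morphism pm_scale M_mult M_succ M_prec scale "(\<^bold>*)" "(\<^bold>\<succ>)" "(\<^bold>\<prec>)" \<psi> by fact
  have "\<phi> (Poly_Mapping.single b 1) = \<psi> (Poly_Mapping.single b 1)" for b
  proof (induction b rule: neforest_induct)
    case dot
    show ?case using assms(3) by (simp add: M_dot_def)
  next
    case (concat x y)
    then show ?case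
      using \<phi>.map_ast[of "Poly_Mapping.single x 1" "Poly_Mapping.single y 1"]
        \<psi>.map_ast[of "Poly_Mapping.single x 1" "Poly_Mapping.single y 1"] by (simp add: M_mult_def)
  next
    case (succ x y)
    then show ?case
      using \<phi>.map_succ[of "Poly_Mapping.single x 1" "Poly_Mapping.single y 1"]
        \<psi>.map_succ[of "Poly_Mapping.single x 1" "Poly_Mapping.single y 1"] by (simp add: M_succ_def)
  next
    case (prec x y)
    then show ?case
      using \<phi>.map_prec[of "Poly_Mapping.single x 1" "Poly_Mapping.single y 1"]
        \<psi>.map_prec[of "Poly_Mapping.single x 1" "Poly_Mapping.single y 1"] by (simp add: M_prec_def)
  qed
  then show ?thesis
    by (rule linear_eq_on_basis[OF \<phi>.linear_axioms \<psi>.linear_axioms])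
qed

end

theorem theorem33:
  shows "bg_algebra (pm_scale :: 'k::field \<Rightarrow> 'k forest_space \<Rightarrow> 'k forest_space) M_mult M_succ M_prec \<and>
    (\<forall>(scale :: 'k \<Rightarrow> 'a::ab_group_add \<Rightarrow> 'a) ast succ prec (a :: 'a).
       bg_algebra scale ast succ prec \<longrightarrow>
       (\<exists>!\<phi>. bg_morphism pm_scale M_mult M_succ M_prec scale ast succ prec \<phi> \<and> \<phi> M_dot = a))"
proof (intro conjI allI impI)
  fix scale :: "'k \<Rightarrow> 'a \<Rightarrow> 'a" and ast succ prec a
  assume "bg_algebra scale ast succ prec"
  then interpret bg_algebra scale ast succ prec .
  show "\<exists>!\<phi>. bg_morphism pm_scale M_mult M_succ M_prec scale ast succ prec \<phi> \<and> \<phi> M_dot = a"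
  proof (rule ex1I)
    show "bg_morphism pm_scale M_mult M_succ M_prec scale ast succ prec (linear_extension scale (eval a)) \<and>
        linear_extension scale (eval a) M_dot = a"
      by (simp add: bg_morphism_eval M_dot_def eval_dot)
  next
    fix \<psi>
    assume "bg_morphism pm_scale M_mult M_succ M_prec scale ast succ prec \<psi> \<and> \<psi> M_dot = a"
    then show "\<psi> = linear_extension scale (eval a)"
      by (intro bg_morphism_eqI) (simp_all add: bg_morphism_eval M_dot_def eval_dot)
  qed
qed (rule bg_algebra_M)

end
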